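(* In the payment network creation game with $n=5$ players, betweenness weight $b\ge 0$ and closeness weight $c>0$, the circle graph (the cycle $C_5$ on all players) is a Nash equilibrium if and only if $b+c\le 1\le 2b+4c$.
   Context: Payment network creation game. There are $n$ players $[n]=\{0,1,\dots,n-1\}$. A strategy of player $u$ is a set $s_u\subseteq [n]\setminus\{u\}$ (the players to whom $u$ opens a channel). A strategy combination is $s=(s_0,\dots,s_{n-1})$, and $G[s]$ is the undirected simple graph on $[n]$ in which $u,v$ are adjacent iff $v\in s_u$ or $u\in s_v$. With weights $b\ge 0$ and $c>0$, the cost of $u$ is $$\mathrm{cost}_u(s)=|s_u|+b\cdot \mathrm{betweenness}_u(s)+c\cdot \mathrm{closeness}_u(s),$$ $$\mathrm{betweenness}_u(s)=(n-1)(n-2)-\sum_{\substack{(i,j)\in[n]^2:\ i\ne j,\ i\neq u,\ j\ne u,\\ m(i,j)>0}}\frac{m_u(i,j)}{m(i,j)},\qquad \mathrm{closeness}_u(s)=\sum_{v\in[n]\setminus\{u\}}\bigl(d_{G[s]}(u,v)-1\bigr).$$ The sum in the betweenness runs over ordered pairs; $m(i,j)$ is the number of shortest paths between $i$ and $j$ in $G[s]$ and $m_u(i,j)$ the number of those passing through $u$; $d_{G[s]}$ is graph distance, equal to $\infty$ between different components. A strategy combination $s$ is a Nash equilibrium if no player can strictly decrease her cost by unilaterally changing her strategy; a graph $G$ is called a Nash equilibrium if $G=G[s]$ for some strategy combination $s$ that is a Nash equilibrium. *)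

theory Defs
  imports
    "Graph_Theory.Pair_Digraph"
    "Graph_Theory.Shortest_Path"
    "HOL-Library.FuncSet"
begin

text \<open>
  The players are the natural numbers below \<open>n\<close>. An undirected simple graph is a
  \<^locale>\<open>pair_graph\<close>, i.e. a finite symmetric loop-free digraph without parallel arcs, in which
  every undirected edge is a pair of opposite arcs.
\<close>

definition strategies :: "nat \<Rightarrow> nat \<Rightarrow> nat set set" where
  "strategies n u = Pow ({..<n} - {u})"

definition strategy_combinations :: "nat \<Rightarrow> (nat \<Rightarrow> nat set) set" where
  "strategy_combinations n = (\<Pi>\<^sub>E u\<in>{..<n}. strategies n u)"

definition strategy_graph :: "nat \<Rightarrow> (nat \<Rightarrow> nat set) \<Rightarrow> nat pair_pre_digraph" where
  "strategy_graph n s =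
     \<lparr> pverts = {..<n},
       parcs = {(u, v). u < n \<and> v < n \<and> (v \<in> s u \<or> u \<in> s v)} \<rparr>"

lemma pair_graph_strategy_graph:
  assumes "s \<in> strategy_combinations n"
  shows "pair_graph (strategy_graph n s)"
proof
  show "finite (pverts (strategy_graph n s))"
    by (simp add: strategy_graph_def)
  show "finite (parcs (strategy_graph n s))"
    by (rule finite_subset[of _ "{..<n} \<times> {..<n}"]) (auto simp: strategy_graph_def)
  show "symmetric (with_proj (strategy_graph n s))"
    by (auto simp: strategy_graph_def symmetric_def arcs_ends_def arc_to_ends_def intro!: symI)
  show "fst e \<noteq> snd e" if "e \<in> parcs (strategy_graph n s)" for e
    using assms that
    by (fastforce simp: strategy_graph_def strategy_combinations_def strategies_def PiE_iff)
qed (auto simp: strategy_graph_def)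

text \<open>Infinite between different components, as an infimum over the empty set of walks.\<close>

definition graph_dist :: "nat pair_pre_digraph \<Rightarrow> nat \<Rightarrow> nat \<Rightarrow> ereal" where
  "graph_dist G u v = wf_digraph.\<mu> (with_proj G) (\<lambda>_. 1) u v"

definition shortest_paths :: "nat pair_pre_digraph \<Rightarrow> nat \<Rightarrow> nat \<Rightarrow> (nat \<times> nat) awalk set" where
  "shortest_paths G i j =
     {p. pre_digraph.apath (with_proj G) i p j \<and> ereal (real (length p)) = graph_dist G i j}"

definition num_shortest_paths :: "nat pair_pre_digraph \<Rightarrow> nat \<Rightarrow> nat \<Rightarrow> nat" where
  "num_shortest_paths G i j = card (shortest_paths G i j)"

definition num_shortest_paths_through ::
    "nat pair_pre_digraph \<Rightarrow> nat \<Rightarrow> nat \<Rightarrow> nat \<Rightarrow> nat" where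
  "num_shortest_paths_through G u i j =
     card {p \<in> shortest_paths G i j. u \<in> set (pawalk_verts i p)}"

definition betweenness :: "nat \<Rightarrow> (nat \<Rightarrow> nat set) \<Rightarrow> nat \<Rightarrow> real" where
  "betweenness n s u =
     (real n - 1) * (real n - 2) -
     (\<Sum>(i, j) \<in> {(i, j). i < n \<and> j < n \<and> i \<noteq> j \<and> i \<noteq> u \<and> j \<noteq> u \<and>
                      num_shortest_paths (strategy_graph n s) i j > 0}.
        real (num_shortest_paths_through (strategy_graph n s) u i j) /
        real (num_shortest_paths (strategy_graph n s) i j))"

definition closeness :: "nat \<Rightarrow> (nat \<Rightarrow> nat set) \<Rightarrow> nat \<Rightarrow> ereal" where
  "closeness n s u = (\<Sum>v \<in> {..<n} - {u}. graph_dist (strategy_graph n s) u v - 1)"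

definition cost :: "nat \<Rightarrow> real \<Rightarrow> real \<Rightarrow> (nat \<Rightarrow> nat set) \<Rightarrow> nat \<Rightarrow> ereal" where
  "cost n b c s u =
     ereal (real (card (s u))) + ereal b * ereal (betweenness n s u) + ereal c * closeness n s u"

definition nash_equilibrium :: "nat \<Rightarrow> real \<Rightarrow> real \<Rightarrow> (nat \<Rightarrow> nat set) \<Rightarrow> bool" where
  "nash_equilibrium n b c s \<longleftrightarrow>
     s \<in> strategy_combinations n \<and>
     (\<forall>u<n. \<forall>t \<in> strategies n u. \<not> cost n b c (s(u := t)) u < cost n b c s u)"

definition graph_nash_equilibrium ::
    "nat \<Rightarrow> real \<Rightarrow> real \<Rightarrow> nat pair_pre_digraph \<Rightarrow> bool" where
  "graph_nash_equilibrium n b c G \<longleftrightarrow>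
     (\<exists>s. nash_equilibrium n b c s \<and> G = strategy_graph n s)"

text \<open>
  A cycle through all \<open>n\<close> players. The bijection \<open>\<sigma>\<close> gives their order around the cycle, so
  every labelling of the cycle is covered, not only \<open>0, 1, \<dots>, n - 1\<close>.
\<close>

definition circle_graph :: "nat \<Rightarrow> nat pair_pre_digraph \<Rightarrow> bool" where
  "circle_graph n G \<longleftrightarrow>
     n \<ge> 3 \<and>
     (\<exists>\<sigma>. bij_betw \<sigma> {..<n} {..<n} \<and>
       G = \<lparr> pverts = {..<n},
             parcs = (\<Union>k<n. {(\<sigma> k, \<sigma> (Suc k mod n)), (\<sigma> (Suc k mod n), \<sigma> k)}) \<rparr>)"

end

theory Submission
  imports Defs
begin

text \<open>
  If each player owns exactly the edge to her successor, then a unilateral change of strategy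
  leaves, up to rotation, the path from 1 to 0 with the edges from 0 to some set \<open>T\<close> of
  the other four players added. Only the sixteen sets \<open>T\<close> have to be compared, and the costs in these
  graphs are computed by enumerating walks, because the shortest paths are exactly the walks of
  minimal length. Conversely, in any equilibrium with graph \<open>C\<^sub>5\<close>, a player owning an edge gains
  nothing by dropping it (which gives \<open>1 \<le> 2 b + 4 c\<close>, and excludes edges owned by both ends) nor by
  opening a chord (which gives \<open>b + c \<le> 1\<close>).
\<close>

section \<open>Executable enumeration of walks, distances and path ratios\<close>

primrec arc_walks :: "('a \<times> 'a) list \<Rightarrow> nat \<Rightarrow> 'a \<Rightarrow> 'a \<Rightarrow> ('a \<times> 'a) list list" where
  "arc_walks es 0 i j = (if i = j then [[]] else [])"
| "arc_walks es (Suc d) i j =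
     concat (map (\<lambda>e. map ((#) e) (arc_walks es d (snd e) j)) (filter (\<lambda>e. fst e = i) es))"

text \<open>The search is cut off at \<open>n\<close>: the value \<open>n\<close> means that no walk shorter than \<open>n\<close> exists.\<close>

definition walk_dist :: "nat \<Rightarrow> ('a \<times> 'a) list \<Rightarrow> 'a \<Rightarrow> 'a \<Rightarrow> nat" where
  "walk_dist n es i j = length (takeWhile (\<lambda>d. arc_walks es d i j = []) [0..<n])"

definition min_walks :: "nat \<Rightarrow> ('a \<times> 'a) list \<Rightarrow> 'a \<Rightarrow> 'a \<Rightarrow> ('a \<times> 'a) list list" where
  "min_walks n es i j = arc_walks es (walk_dist n es i j) i j"

text \<open>Numerators and denominators stay natural numbers, so that evaluation postpones real
  division. All ordered pairs avoiding \<open>u\<close> are kept, since in the connected graphs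
  considered every denominator is positive.\<close>

definition path_ratios :: "nat \<Rightarrow> (nat \<times> nat) list \<Rightarrow> nat \<Rightarrow> (nat \<times> nat) list" where
  "path_ratios n es u =
     map (\<lambda>(i, j). (length (filter (\<lambda>p. u \<in> set (pawalk_verts i p)) (min_walks n es i j)),
                   length (min_walks n es i j)))
       (filter (\<lambda>(i, j). i \<noteq> j \<and> i \<noteq> u \<and> j \<noteq> u) (List.product [0..<n] [0..<n]))"

definition dist_sum :: "nat \<Rightarrow> (nat \<times> nat) list \<Rightarrow> nat \<Rightarrow> nat" where
  "dist_sum n es u = (\<Sum>v\<leftarrow>filter (\<lambda>v. v \<noteq> u) [0..<n]. walk_dist n es u v)"

text \<open>Without \<open>remdups\<close>, an edge bought by both ends would yield repeated arcs
  and inflate the path counts.\<close>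

definition sym_arcs :: "('a \<times> 'a) list \<Rightarrow> ('a \<times> 'a) list" where
  "sym_arcs es = remdups (es @ map prod.swap es)"

text \<open>The player who deviates is always \<open>0\<close>; the arc \<open>(4, 0)\<close> belongs to player \<open>4\<close>.\<close>

definition deviation_arcs :: "nat list \<Rightarrow> (nat \<times> nat) list" where
  "deviation_arcs T = sym_arcs ([(1, 2), (2, 3), (3, 4), (4, 0)] @ map (Pair 0) T)"

text \<open>The quantifiers range over explicit lists so that the condition can be decided by
  evaluation.\<close>

definition connected_upto :: "nat \<Rightarrow> (nat \<times> nat) list \<Rightarrow> bool" where
  "connected_upto n es \<longleftrightarrow> (\<forall>i\<in>set [0..<n]. \<forall>j\<in>set [0..<n]. walk_dist n es i j < n)"

section \<open>Correctness and relabelling of the walk enumeration\<close>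

lemma distinct_concat_map_Cons:
  assumes "distinct es" and "\<And>e. distinct (W e)"
  shows "distinct (concat (map (\<lambda>e. map ((#) e) (W e)) es))"
  using assms(1) by (induction es) (auto simp: distinct_map assms(2) inj_on_def)

text \<open>Walks with different first arcs lie in disjoint blocks. Hence no walk is listed twice,
  and \<open>length\<close> counts walks.\<close>

lemma distinct_arc_walks: "distinct es \<Longrightarrow> distinct (arc_walks es d i j)"
  by (induction d arbitrary: i) (auto intro!: distinct_concat_map_Cons)

lemma set_arc_walks_subset: "p \<in> set (arc_walks es d i j) \<Longrightarrow> set p \<subseteq> set es"
  by (induction d arbitrary: i p) (fastforce split: if_splits)+

lemma set_arc_walks:
  assumes "pair_wf_digraph G" and "parcs G = set es" and "i \<in> pverts G"
  shows "set (arc_walks es d i j) = {p. pre_digraph.awalk (with_proj G) i p j \<and> length p = d}"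
  using assms(3)
proof (induction d arbitrary: i)
  interpret pair_wf_digraph G by fact
  case 0
  then show ?case by (auto simp: awalk_Nil_iff)
next
  interpret pair_wf_digraph G by fact
  case (Suc d)
  have "set (arc_walks es (Suc d) i j) =
      (\<Union>e\<in>{e \<in> parcs G. fst e = i}. (#) e ` set (arc_walks es d (snd e) j))"
    by (simp add: assms(2))
  also have "\<dots> = (\<Union>e\<in>{e \<in> parcs G. fst e = i}. (#) e ` {p. awalk (snd e) p j \<and> length p = d})"
    using Suc.IH arc_snd_in_verts by simp
  also have "\<dots> = {p. awalk i p j \<and> length p = Suc d}"
    by (auto simp: awalk_Cons_iff length_Suc_conv)
  finally show ?case .
qed

text \<open>Injectivity on \<open>V\<close> makes selecting arcs by their tail commute with
  relabelling. This reduces an arbitrarily labelled circle to computations on the fixed labels 0 to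
  4.\<close>

lemma arc_walks_map:
  assumes "inj_on f V" and "set es \<subseteq> V \<times> V" and "i \<in> V" and "j \<in> V"
  shows "arc_walks (map (map_prod f f) es) d (f i) (f j) =
    map (map (map_prod f f)) (arc_walks es d i j)"
  using assms(3)
proof (induction d arbitrary: i)
  case 0
  then show ?case using assms(1,4) by (auto dest: inj_onD)
next
  case (Suc d)
  have eq: "f (fst e) = f i \<longleftrightarrow> fst e = i" if "e \<in> set es" for e
    using inj_on_eq_iff[OF assms(1)] assms(2) Suc.prems that by auto
  have IH: "arc_walks (map (map_prod f f) es) d (f (snd e)) (f j) =
      map (map (map_prod f f)) (arc_walks es d (snd e) j)" if "e \<in> set es" for e
    using Suc.IH[of "snd e"] assms(2) that by auto
  have "filter (\<lambda>e. fst e = f i) (map (map_prod f f) es) =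
      map (map_prod f f) (filter (\<lambda>e. fst e = i) es)"
    by (simp add: filter_map comp_def eq cong: filter_cong)
  then show ?case
    using IH by (auto simp: map_concat comp_def intro!: arg_cong[of _ _ concat])
qed

lemma walk_dist_map:
  assumes "inj_on f V" and "set es \<subseteq> V \<times> V" and "i \<in> V" and "j \<in> V"
  shows "walk_dist n (map (map_prod f f) es) (f i) (f j) = walk_dist n es i j"
  by (simp add: walk_dist_def arc_walks_map[OF assms])

lemma min_walks_map:
  assumes "inj_on f V" and "set es \<subseteq> V \<times> V" and "i \<in> V" and "j \<in> V"
  shows "min_walks n (map (map_prod f f) es) (f i) (f j) =
    map (map (map_prod f f)) (min_walks n es i j)"
  by (simp add: min_walks_def walk_dist_map[OF assms] arc_walks_map[OF assms])

lemma pawalk_verts_map: "pawalk_verts (f i) (map (map_prod f f) p) = map f (pawalk_verts i p)"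
  by (induction p arbitrary: i) auto

lemma min_walks_nonempty:
  assumes "walk_dist n es i j < n"
  shows "min_walks n es i j \<noteq> []"
  using nth_length_takeWhile[of "\<lambda>d. arc_walks es d i j = []" "[0..<n]"] assms
  by (simp add: min_walks_def walk_dist_def)

lemma arc_walks_below_walk_dist:
  assumes "d < walk_dist n es i j"
  shows "arc_walks es d i j = []"
proof -
  have "walk_dist n es i j \<le> n"
    using length_takeWhile_le[of "\<lambda>d. arc_walks es d i j = []" "[0..<n]"]
    by (simp add: walk_dist_def)
  \<comment> \<open>Entry \<open>d\<close> of \<open>[0..<n]\<close> is \<open>d\<close> itself, so
    positions and tested lengths agree.\<close>
  then have "takeWhile (\<lambda>d. arc_walks es d i j = []) [0..<n] ! d = d"
    using assms by (simp add: takeWhile_nth walk_dist_def)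
  then have "d \<in> set (takeWhile (\<lambda>d. arc_walks es d i j = []) [0..<n])"
    using assms nth_mem by (fastforce simp: walk_dist_def)
  then show ?thesis by (blast dest: set_takeWhileD)
qed

section \<open>Graph distance and shortest paths via minimal walks\<close>

context
  fixes G :: "nat pair_pre_digraph" and es n i j
  assumes wf: "pair_wf_digraph G" and arcs: "parcs G = set es" and i: "i \<in> pverts G"
    and reach: "walk_dist n es i j < n"
begin

interpretation pair_wf_digraph G by (rule wf)

lemma length_ge_walk_dist: "awalk i p j \<Longrightarrow> walk_dist n es i j \<le> length p"
  using set_arc_walks[OF wf arcs i, of "length p" j] arc_walks_below_walk_dist[of "length p" n es i j]
  by (cases "length p < walk_dist n es i j") auto

lemma set_min_walks: "set (min_walks n es i j) = {p. awalk i p j \<and> length p = walk_dist n es i j}"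
  unfolding min_walks_def by (rule set_arc_walks[OF wf arcs i])

text \<open>By \<open>reach\<close> the value is not the cutoff, so some walk attains the infimum
  that defines the distance.\<close>

lemma graph_dist_eq_walk_dist: "graph_dist G i j = ereal (real (walk_dist n es i j))"
proof -
  obtain p where p: "awalk i p j" "length p = walk_dist n es i j"
    using min_walks_nonempty[OF reach] set_min_walks by (cases "min_walks n es i j") auto
  have "graph_dist G i j = (INF p\<in>{p. awalk i p j}. ereal (real (length p)))"
    by (simp add: graph_dist_def \<mu>_def awalk_cost_def sum_list_triv)
  also have "\<dots> = ereal (real (walk_dist n es i j))"
  proof (rule antisym)
    show "(INF p\<in>{p. awalk i p j}. ereal (real (length p))) \<le> ereal (real (walk_dist n es i j))"
      using p by (auto intro: INF_lower2)
    show "ereal (real (walk_dist n es i j)) \<le> (INF p\<in>{p. awalk i p j}. ereal (real (length p)))"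
      using length_ge_walk_dist by (auto intro: INF_greatest)
  qed
  finally show ?thesis .
qed

text \<open>A repeated vertex would enclose a nonempty closed subwalk \<open>r\<close>; deleting it
  leaves a walk shorter than the minimum. So counting minimal walks counts shortest paths.\<close>

lemma apath_if_shortest:
  assumes "awalk i p j" and "length p = walk_dist n es i j"
  shows "apath i p j"
proof (rule ccontr)
  assume "\<not> apath i p j"
  with assms(1) have "\<not> distinct (awalk_verts i p)" by (simp add: apath_def)
  from awalk_not_distinct_decomp[OF assms(1) this]
  obtain q r s w where "p = q @ r @ s" "awalk i q w" "r \<noteq> []" "awalk w s j"
    by auto
  then show False
    using length_ge_walk_dist[of "q @ s"] awalk_appendI[of i q w s j] assms(2)
    by (cases r) auto
qed

lemma shortest_paths_eq_min_walks: "shortest_paths G i j = set (min_walks n es i j)"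
  using apath_if_shortest
  by (auto simp: shortest_paths_def set_min_walks graph_dist_eq_walk_dist intro: awalkI_apath)

end

section \<open>Costs computed on the labels\<close>

lemma sum_list_filter_upt:
  fixes f :: "nat \<Rightarrow> 'a::comm_monoid_add"
  shows "(\<Sum>v\<leftarrow>filter P [0..<n]. f v) = (\<Sum>v \<in> {v. v < n \<and> P v}. f v)"
  by (subst sum_list_distinct_conv_sum_set) (auto intro!: sum.cong)

text \<open>Connectivity makes all distances finite, so the extended real cost becomes a real
  expression in computable counts. Inside the sum, \<open>b\<close> is a bound denominator, not the
  betweenness weight.\<close>

lemma cost_relabelled:
  assumes bij: "bij_betw \<sigma> {..<n} {..<n}"
    and G: "strategy_graph n s = \<lparr>pverts = {..<n}, parcs = map_prod \<sigma> \<sigma> ` set es\<rparr>"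
    and es: "distinct es" "set es \<subseteq> {..<n} \<times> {..<n}" "connected_upto n es"
    and u: "u < n"
  shows "cost n b c s (\<sigma> u) = ereal (real (card (s (\<sigma> u))) +
    b * ((real n - 1) * (real n - 2) - (\<Sum>(a, b)\<leftarrow>path_ratios n es u. real a / real b)) +
    c * (real (dist_sum n es u) - (real n - 1)))"
proof -
  let ?G = "strategy_graph n s" and ?f = "map_prod \<sigma> \<sigma>"
  let ?es = "map ?f es"
  have inj: "inj_on \<sigma> {..<n}" and img: "\<sigma> ` {..<n} = {..<n}"
    using bij by (auto simp: bij_betw_def)
  have \<sigma>_less: "\<sigma> i < n" if "i < n" for i
    using img that by auto
  have \<sigma>_eq: "\<sigma> i = \<sigma> j \<longleftrightarrow> i = j" if "i < n" "j < n" for i j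
    using inj that by (auto dest: inj_onD)
  have wf: "pair_wf_digraph ?G"
    by unfold_locales (auto simp: strategy_graph_def)
  have arcs: "parcs ?G = set ?es" and verts: "pverts ?G = {..<n}"
    by (simp_all add: G)
  have dist: "walk_dist n ?es (\<sigma> i) (\<sigma> j) = walk_dist n es i j"
    and walks: "min_walks n ?es (\<sigma> i) (\<sigma> j) = map (map ?f) (min_walks n es i j)"
    if "i < n" "j < n" for i j
    using walk_dist_map[OF inj es(2)] min_walks_map[OF inj es(2)] that by auto
  have reach: "walk_dist n es i j < n" if "i < n" "j < n" for i j
    using es(3) that by (auto simp: connected_upto_def)
  have inj_f: "inj_on ?f (set es)"
    using map_prod_inj_on[OF inj inj] es(2) by (rule inj_on_subset)
  then have "distinct ?es"
    using es(1) by (simp add: distinct_map)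
  then have distinct: "distinct (map (map ?f) (min_walks n es i j))" if "i < n" "j < n" for i j
    using distinct_arc_walks[of ?es "walk_dist n ?es (\<sigma> i) (\<sigma> j)" "\<sigma> i" "\<sigma> j"] walks[OF that]
    by (simp add: min_walks_def)
  have gd: "graph_dist ?G (\<sigma> i) (\<sigma> j) = ereal (real (walk_dist n es i j))"
    and sp: "shortest_paths ?G (\<sigma> i) (\<sigma> j) = set (map (map ?f) (min_walks n es i j))"
    if "i < n" "j < n" for i j
    using graph_dist_eq_walk_dist[OF wf arcs, of "\<sigma> i" n "\<sigma> j"]
      shortest_paths_eq_min_walks[OF wf arcs, of "\<sigma> i" n "\<sigma> j"]
      \<sigma>_less dist[OF that] reach[OF that] walks[OF that] that
    by (auto simp: verts)
  have num: "num_shortest_paths ?G (\<sigma> i) (\<sigma> j) = length (min_walks n es i j)"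
    if "i < n" "j < n" for i j
    unfolding num_shortest_paths_def sp[OF that] using distinct_card[OF distinct[OF that]] by simp
  have through: "num_shortest_paths_through ?G (\<sigma> u) (\<sigma> i) (\<sigma> j) =
      length (filter (\<lambda>p. u \<in> set (pawalk_verts i p)) (min_walks n es i j))"
    if "i < n" "j < n" for i j
  proof -
    have mem: "\<sigma> u \<in> set (pawalk_verts (\<sigma> i) (map ?f p)) \<longleftrightarrow> u \<in> set (pawalk_verts i p)"
      if p: "p \<in> set (min_walks n es i j)" for p
    proof -
      \<comment> \<open>\<open>\<sigma>\<close> is injective only on the players, so the vertices of
        the walk must first be located there.\<close>
      have "set p \<subseteq> set es \<Longrightarrow> set (pawalk_verts i p) \<subseteq> {..<n}"
        using \<open>i < n\<close>
      proof (induction p arbitrary: i)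
        case (Cons e p)
        then show ?case using es(2) by fastforce
      qed simp
      then have "set (pawalk_verts i p) \<subseteq> {..<n}"
        using p set_arc_walks_subset unfolding min_walks_def by metis
      then show ?thesis
        using inj_on_image_mem_iff[OF inj, of u "set (pawalk_verts i p)"] u
        by (simp add: pawalk_verts_map)
    qed
    have "{p \<in> shortest_paths ?G (\<sigma> i) (\<sigma> j). \<sigma> u \<in> set (pawalk_verts (\<sigma> i) p)} =
        set (filter (\<lambda>p. \<sigma> u \<in> set (pawalk_verts (\<sigma> i) p)) (map (map ?f) (min_walks n es i j)))"
      unfolding sp[OF that] by auto
    also have "card \<dots> =
        length (filter (\<lambda>p. \<sigma> u \<in> set (pawalk_verts (\<sigma> i) p)) (map (map ?f) (min_walks n es i j)))"
      by (rule distinct_card[OF distinct_filter[OF distinct[OF that]]])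
    also have "\<dots> = length (filter (\<lambda>p. u \<in> set (pawalk_verts i p)) (min_walks n es i j))"
      using mem by (simp add: filter_map comp_def cong: filter_cong)
    finally show ?thesis by (simp add: num_shortest_paths_through_def)
  qed
  let ?r = "\<lambda>(i, j). real (num_shortest_paths_through ?G (\<sigma> u) i j) / real (num_shortest_paths ?G i j)"
  let ?P = "{(i, j). i < n \<and> j < n \<and> i \<noteq> j \<and> i \<noteq> u \<and> j \<noteq> u}"
  have pos: "num_shortest_paths ?G (\<sigma> i) (\<sigma> j) > 0" if "i < n" "j < n" for i j
    using min_walks_nonempty[OF reach[OF that]] by (simp add: num[OF that])
  \<comment> \<open>By connectivity the positivity condition in \<open>betweenness\<close> holds for
    every pair, which leaves just the relabelled pairs.\<close>
  have pairs: "{(i, j). i < n \<and> j < n \<and> i \<noteq> j \<and> i \<noteq> \<sigma> u \<and> j \<noteq> \<sigma> u \<and>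
      num_shortest_paths ?G i j > 0} = ?f ` ?P" (is "?L = _")
  proof (intro subset_antisym subsetI)
    fix x assume "x \<in> ?L"
    then obtain i j where x: "x = (i, j)" "i < n" "j < n" "i \<noteq> j" "i \<noteq> \<sigma> u" "j \<noteq> \<sigma> u"
      by auto
    moreover obtain i' j' where "i' < n" "i = \<sigma> i'" "j' < n" "j = \<sigma> j'"
      using img x(2,3) by (metis imageE lessThan_iff)
    ultimately show "x \<in> ?f ` ?P" by (intro image_eqI[of _ _ "(i', j')"]) auto
  next
    fix x assume "x \<in> ?f ` ?P"
    then show "x \<in> ?L" using \<sigma>_less \<sigma>_eq pos u by auto
  qed
  have "inj_on ?f ?P"
    by (rule inj_on_subset[OF map_prod_inj_on[OF inj inj]]) auto
  then have "sum ?r (?f ` ?P) = sum (?r \<circ> ?f) ?P"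
    by (rule sum.reindex)
  also have "\<dots> = (\<Sum>(i, j)\<in>?P.
      real (length (filter (\<lambda>p. u \<in> set (pawalk_verts i p)) (min_walks n es i j))) /
      real (length (min_walks n es i j)))"
    by (rule sum.cong) (auto simp: num through)
  also have "\<dots> = (\<Sum>(i, j)\<leftarrow>filter (\<lambda>(i, j). i \<noteq> j \<and> i \<noteq> u \<and> j \<noteq> u) (List.product [0..<n] [0..<n]).
      real (length (filter (\<lambda>p. u \<in> set (pawalk_verts i p)) (min_walks n es i j))) /
      real (length (min_walks n es i j)))"
    by (subst sum_list_distinct_conv_sum_set)
      (auto intro!: sum.cong distinct_filter distinct_product)
  also have "\<dots> = (\<Sum>(a, b)\<leftarrow>path_ratios n es u. real a / real b)"
    by (simp add: path_ratios_def comp_def case_prod_unfold)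
  finally have betw: "betweenness n s (\<sigma> u) =
      (real n - 1) * (real n - 2) - (\<Sum>(a, b)\<leftarrow>path_ratios n es u. real a / real b)"
    by (simp add: betweenness_def pairs)
  have rest: "{..<n} - {\<sigma> u} = \<sigma> ` ({..<n} - {u})"
    using inj_on_image_set_diff[OF inj, of "{..<n}" "{u}"] img u by auto
  have "closeness n s (\<sigma> u) = (\<Sum>v\<in>{..<n} - {u}. graph_dist ?G (\<sigma> u) (\<sigma> v) - 1)"
    unfolding closeness_def rest
    by (subst sum.reindex) (auto intro: inj_on_subset[OF inj])
  \<comment> \<open>The summand -1 occurs once for each of the \<open>n - 1\<close> other
    players.\<close>
  also have "\<dots> = (\<Sum>v\<in>{..<n} - {u}. ereal (real (walk_dist n es u v) - 1))"
    using u by (intro sum.cong) (auto simp: gd one_ereal_def)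
  also have "\<dots> = ereal (real (\<Sum>v\<in>{..<n} - {u}. walk_dist n es u v) - (real n - 1))"
    using u by (simp add: sum_subtractf)
  also have "(\<Sum>v\<in>{..<n} - {u}. walk_dist n es u v) = dist_sum n es u"
    unfolding dist_sum_def sum_list_filter_upt by (rule sum.cong) auto
  finally show ?thesis
    by (simp add: cost_def betw)
qed

section \<open>Adjacency in relabelled strategy graphs\<close>

lemma strategy_graph_relabelled:
  assumes "bij_betw \<tau> {..<n} {..<n}" and "E \<subseteq> {..<n} \<times> {..<n}"
    and "\<And>i j. i < n \<Longrightarrow> j < n \<Longrightarrow> (\<tau> j \<in> s (\<tau> i) \<or> \<tau> i \<in> s (\<tau> j)) \<longleftrightarrow> (i, j) \<in> E"
  shows "strategy_graph n s = \<lparr>pverts = {..<n}, parcs = map_prod \<tau> \<tau> ` E\<rparr>"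
proof -
  have img: "\<tau> ` {..<n} = {..<n}"
    using assms(1) by (simp add: bij_betw_def)
  have "{(x, y). x < n \<and> y < n \<and> (y \<in> s x \<or> x \<in> s y)} = map_prod \<tau> \<tau> ` E"
  proof (intro subset_antisym subsetI)
    fix e assume "e \<in> {(x, y). x < n \<and> y < n \<and> (y \<in> s x \<or> x \<in> s y)}"
    then obtain x y where e: "e = (x, y)" "x < n" "y < n" "y \<in> s x \<or> x \<in> s y"
      by auto
    moreover obtain i j where "i < n" "x = \<tau> i" "j < n" "y = \<tau> j"
      using img e(2,3) by (metis imageE lessThan_iff)
    ultimately show "e \<in> map_prod \<tau> \<tau> ` E"
      using assms(3) by (intro image_eqI[of _ _ "(i, j)"]) auto
  next
    fix e assume "e \<in> map_prod \<tau> \<tau> ` E"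
    then obtain i j where ij: "(i, j) \<in> E" "e = (\<tau> i, \<tau> j)"
      by auto
    then have "i < n" "j < n"
      using assms(2) by auto
    then show "e \<in> {(x, y). x < n \<and> y < n \<and> (y \<in> s x \<or> x \<in> s y)}"
      using assms(3)[of i j] bij_betwE[OF assms(1)] ij by simp
  qed
  then show ?thesis by (simp only: strategy_graph_def)
qed

text \<open>Converse of \<open>strategy_graph_relabelled\<close>: injectivity of
  \<open>\<tau>\<close> pulls arcs back to labels.\<close>

lemma adjacent_iff_relabelled:
  assumes "bij_betw \<tau> {..<n} {..<n}" and "E \<subseteq> {..<n} \<times> {..<n}"
    and "strategy_graph n s = \<lparr>pverts = {..<n}, parcs = map_prod \<tau> \<tau> ` E\<rparr>"
    and "i < n" and "j < n"
  shows "(\<tau> j \<in> s (\<tau> i) \<or> \<tau> i \<in> s (\<tau> j)) \<longleftrightarrow> (i, j) \<in> E"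
proof -
  have inj: "inj_on \<tau> {..<n}" and less: "\<tau> i < n" "\<tau> j < n"
    using assms(1,4,5) by (auto simp: bij_betw_def)
  have "(\<tau> j \<in> s (\<tau> i) \<or> \<tau> i \<in> s (\<tau> j)) \<longleftrightarrow> (\<tau> i, \<tau> j) \<in> parcs (strategy_graph n s)"
    using less by (simp add: strategy_graph_def)
  also have "\<dots> \<longleftrightarrow> (\<tau> i, \<tau> j) \<in> map_prod \<tau> \<tau> ` E"
    by (simp add: assms(3))
  also have "\<dots> \<longleftrightarrow> (i, j) \<in> E"
    using inj_on_image_mem_iff[OF map_prod_inj_on[OF inj inj], of "(i, j)" E] assms(2,4,5) by simp
  finally show ?thesis .
qed

section \<open>Labellings of the five-cycle and its symmetries\<close>

text \<open>\<open>deviation_arcs [1]\<close> is the cycle itself: the path from 1 to 0, closed by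
  the edge from 0 to 1.\<close>

definition cycle_labelling :: "(nat \<Rightarrow> nat) \<Rightarrow> nat pair_pre_digraph \<Rightarrow> bool" where
  "cycle_labelling \<sigma> G \<longleftrightarrow> bij_betw \<sigma> {..<5} {..<5} \<and>
     G = \<lparr>pverts = {..<5}, parcs = map_prod \<sigma> \<sigma> ` set (deviation_arcs [1])\<rparr>"

lemma set_deviation_arcs:
  "set (deviation_arcs T) =
     {(1, 2), (2, 3), (3, 4), (4, 0), (2, 1), (3, 2), (4, 3), (0, 4)} \<union>
     Pair 0 ` set T \<union> (\<lambda>j. (j, 0)) ` set T"
  unfolding deviation_arcs_def sym_arcs_def by (auto simp: image_iff)

text \<open>Reads each arc through its owner: label 0 buys the edges to \<open>T\<close>, every
  other label the edge to its successor modulo 5.\<close>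

lemma mem_deviation_arcs_iff:
  assumes "i < 5" and "j < 5" and "0 \<notin> set T"
  shows "(i, j) \<in> set (deviation_arcs T) \<longleftrightarrow>
    (if i = 0 then j \<in> set T else j = Suc i mod 5) \<or> (if j = 0 then i \<in> set T else i = Suc j mod 5)"
proof -
  have "i = 0 \<or> i = 1 \<or> i = 2 \<or> i = 3 \<or> i = 4" "j = 0 \<or> j = 1 \<or> j = 2 \<or> j = 3 \<or> j = 4"
    using assms by auto
  then show ?thesis
    using assms(3) unfolding set_deviation_arcs by (elim disjE) (simp_all add: image_iff)
qed

lemma distinct_deviation_arcs: "distinct (deviation_arcs T)"
  by (simp add: deviation_arcs_def sym_arcs_def)

lemma circle_graph_labelling:
  assumes "circle_graph 5 G"
  obtains \<sigma> where "cycle_labelling \<sigma> G"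
proof -
  obtain \<sigma> where bij: "bij_betw \<sigma> {..<5} {..<5}"
    and G: "G = \<lparr>pverts = {..<5},
      parcs = (\<Union>k<5. {(\<sigma> k, \<sigma> (Suc k mod 5)), (\<sigma> (Suc k mod 5), \<sigma> k)})\<rparr>"
    using assms by (auto simp: circle_graph_def)
  have "{..<5::nat} = {0, 1, 2, 3, 4}" by auto
  then have "parcs G = map_prod \<sigma> \<sigma> ` set (deviation_arcs [1])"
    unfolding set_deviation_arcs G by (auto simp: numeral_2_eq_2)
  then show thesis
    using bij G by (intro that[of \<sigma>]) (simp add: cycle_labelling_def)
qed

text \<open>The last two assumptions say that \<open>\<rho>\<close> permutes the labels and
  preserves the cycle; their list form lets evaluation discharge them for concrete
  \<open>\<rho>\<close>.\<close>

lemma cycle_labelling_comp: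
  assumes "cycle_labelling \<sigma> G" and "set (map \<rho> [0..<5]) = set [0..<5]"
    and "set (map (map_prod \<rho> \<rho>) (deviation_arcs [1])) = set (deviation_arcs [1])"
  shows "cycle_labelling (\<sigma> \<circ> \<rho>) G"
proof -
  have img: "\<rho> ` {..<5} = {..<5}"
    using assms(2) by (simp only: set_map set_upt atLeast0LessThan)
  then have "inj_on \<rho> {..<5}"
    by (intro eq_card_imp_inj_on) auto
  with img have "bij_betw \<rho> {..<5} {..<5}"
    by (simp add: bij_betw_def)
  moreover have "map_prod (\<sigma> \<circ> \<rho>) (\<sigma> \<circ> \<rho>) ` set (deviation_arcs [1]) =
      map_prod \<sigma> \<sigma> ` set (deviation_arcs [1])"
    unfolding map_prod_compose image_comp[symmetric] using assms(3) by (simp only: set_map)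
  ultimately show ?thesis
    using assms(1) by (auto simp: cycle_labelling_def intro: bij_betw_trans)
qed

text \<open>Serves to give any chosen player the label 0.\<close>

lemma cycle_labelling_rotate:
  assumes "cycle_labelling \<sigma> G" and "k < 5"
  shows "cycle_labelling (\<lambda>i. \<sigma> ((i + k) mod 5)) G"
proof -
  have "\<forall>k\<in>set [0..<5]. set (map (\<lambda>i. (i + k) mod 5) [0..<5]) = set [0..<5::nat] \<and>
      set (map (map_prod (\<lambda>i. (i + k) mod 5) (\<lambda>i. (i + k) mod 5)) (deviation_arcs [1])) =
        set (deviation_arcs [1])"
    by code_simp
  then show ?thesis
    using cycle_labelling_comp[OF assms(1), of "\<lambda>i. (i + k) mod 5"] assms(2)
    by (simp add: comp_def)
qed

text \<open>This reflection swaps 0 with 1 and 2 with 4 and fixes 3, so either end of the edge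
  between 0 and 1 can be called 0.\<close>

lemma cycle_labelling_reflect:
  assumes "cycle_labelling \<sigma> G"
  shows "cycle_labelling (\<lambda>i. \<sigma> ((6 - i) mod 5)) G"
proof -
  have "set (map (\<lambda>i. (6 - i) mod 5) [0..<5]) = set [0..<5::nat] \<and>
      set (map (map_prod (\<lambda>i. (6 - i) mod 5) (\<lambda>i. (6 - i) mod 5)) (deviation_arcs [1])) =
        set (deviation_arcs [1])"
    by code_simp
  then show ?thesis
    using cycle_labelling_comp[OF assms, of "\<lambda>i. (6 - i) mod 5"] by (simp add: comp_def)
qed

section \<open>The sixteen possible neighbourhood choices of one player\<close>

definition deviation_value :: "nat list \<Rightarrow> real \<times> nat" where
  "deviation_value T =
     (\<Sum>(a, b)\<leftarrow>path_ratios 5 (deviation_arcs T) 0. real a / real b, dist_sum 5 (deviation_arcs T) 0)"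

text \<open>\<open>subseqs\<close> runs from \<open>[1, 2, 3, 4]\<close> down to \<open>[]\<close>,
  each set containing 4 directly followed by the same set without 4. Those two values agree, because
  player 4 already owns the edge to 0.\<close>

lemma deviation_value_table:
  "map deviation_value (subseqs [1, 2, 3, 4]) =
     [(4, 4), (4, 4), (3, 5), (3, 5), (3, 5), (3, 5), (2, 6), (2, 6),
      (2, 5), (2, 5), (2, 6), (2, 6), (0, 7), (0, 7), (0, 10), (0, 10)]"
  by code_simp

lemma connected_deviation_arcs:
  "\<forall>T\<in>set (subseqs [1, 2, 3, 4]). connected_upto 5 (deviation_arcs T)"
  by code_simp

text \<open>Here 12 = (5 - 1)(5 - 2) and 4 = 5 - 1. The number of channels stays symbolic because
  the graph does not determine it: an edge may be bought by both ends.\<close>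

lemma cost_deviation:
  assumes "bij_betw \<sigma> {..<5} {..<5}" and T: "T \<in> set (subseqs [1, 2, 3, 4])"
    and "strategy_graph 5 s = \<lparr>pverts = {..<5}, parcs = map_prod \<sigma> \<sigma> ` set (deviation_arcs T)\<rparr>"
  shows "cost 5 b c s (\<sigma> 0) = ereal (real (card (s (\<sigma> 0))) +
    b * (12 - fst (deviation_value T)) + c * (real (snd (deviation_value T)) - 4))"
proof -
  have "set T \<in> set ` set (subseqs [1, 2, 3, 4])"
    using T by (rule imageI)
  then have "set T \<subseteq> {1, 2, 3, 4}"
    unfolding subseqs_powset by simp
  then have "set (deviation_arcs T) \<subseteq> {..<5} \<times> {..<5}"
    unfolding set_deviation_arcs by fastforce
  from cost_relabelled[OF assms(1,3) distinct_deviation_arcs this bspec[OF connected_deviation_arcs T]]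
  show ?thesis
    by (simp add: deviation_value_def)
qed

section \<open>Necessity of the two bounds\<close>

lemma circle_nash_equilibrium_imp_bounds:
  assumes "circle_graph 5 G" and "graph_nash_equilibrium 5 b c G"
  shows "b + c \<le> 1 \<and> 1 \<le> 2 * b + 4 * c"
proof -
  obtain s where s: "s \<in> strategy_combinations 5" and G: "G = strategy_graph 5 s"
    and nash: "\<And>u t. u < 5 \<Longrightarrow> t \<in> strategies 5 u \<Longrightarrow> \<not> cost 5 b c (s(u := t)) u < cost 5 b c s u"
    using assms(2) by (auto simp: graph_nash_equilibrium_def nash_equilibrium_def)
  let ?arcs = "\<lambda>T. set (deviation_arcs T)"
  have sub: "?arcs [] \<subseteq> {..<5} \<times> {..<5}" "?arcs [1] \<subseteq> {..<5} \<times> {..<5}"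
      "?arcs [1, 2] \<subseteq> {..<5} \<times> {..<5}"
    by (auto simp: set_deviation_arcs)
  \<comment> \<open>Some end of the edge between labels 0 and 1 owns it; after a reflection if
    necessary, it is label 0.\<close>
  have "\<exists>\<sigma>. cycle_labelling \<sigma> G \<and> \<sigma> 1 \<in> s (\<sigma> 0)"
  proof -
    obtain \<sigma> where \<sigma>: "cycle_labelling \<sigma> G"
      using circle_graph_labelling[OF assms(1)] .
    have "\<sigma> 1 \<in> s (\<sigma> 0) \<or> \<sigma> 0 \<in> s (\<sigma> 1)"
      using adjacent_iff_relabelled[of \<sigma> 5 "?arcs [1]" s 0 1] sub \<sigma> G
      by (simp add: cycle_labelling_def set_deviation_arcs)
    then show ?thesis
      using \<sigma> cycle_labelling_reflect[OF \<sigma>] by force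
  qed
  then obtain \<sigma> where \<sigma>: "cycle_labelling \<sigma> G" and owner: "\<sigma> 1 \<in> s (\<sigma> 0)"
    by blast
  have bij: "bij_betw \<sigma> {..<5} {..<5}"
    and graph: "strategy_graph 5 s = \<lparr>pverts = {..<5}, parcs = map_prod \<sigma> \<sigma> ` ?arcs [1]\<rparr>"
    using \<sigma> G by (auto simp: cycle_labelling_def)
  have eq: "\<sigma> i = \<sigma> j \<longleftrightarrow> i = j" if "i < 5" "j < 5" for i j
    using bij that by (auto simp: bij_betw_def dest: inj_onD)
  have less: "\<sigma> i < 5" if "i < 5" for i
    using bij_betwE[OF bij] that by simp
  note adj = adjacent_iff_relabelled[OF bij sub(2) graph]
  have su: "s (\<sigma> 0) \<subseteq> {..<5} - {\<sigma> 0}"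
    using s less[of 0] by (auto simp: strategy_combinations_def strategies_def PiE_iff)
  then have fin: "finite (s (\<sigma> 0))"
    by (rule finite_subset) simp
  have table_values: "deviation_value [] = (0, 10)" "deviation_value [1] = (2, 6)"
      "deviation_value [1, 2] = (3, 5)"
    using deviation_value_table by simp_all
  have cost: "cost 5 b c s (\<sigma> 0) = ereal (real (card (s (\<sigma> 0))) + 10 * b + 2 * c)"
    using cost_deviation[OF bij _ graph, of b c] table_values by simp
  have "b + c \<le> 1"
  proof -
    \<comment> \<open>The chord to \<open>\<sigma> 2\<close> costs 1 and lowers betweenness from 10
      to 9 and closeness from 2 to 1.\<close>
    let ?s = "s(\<sigma> 0 := insert (\<sigma> 2) (s (\<sigma> 0)))"
    have "\<sigma> 2 \<notin> s (\<sigma> 0)"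
      using adj[of 0 2] by (auto simp: set_deviation_arcs)
    then have card: "card (?s (\<sigma> 0)) = card (s (\<sigma> 0)) + 1"
      using fin by simp
    have "strategy_graph 5 ?s = \<lparr>pverts = {..<5}, parcs = map_prod \<sigma> \<sigma> ` ?arcs [1, 2]\<rparr>"
    proof (rule strategy_graph_relabelled[OF bij sub(3)])
      fix i j :: nat assume ij: "i < 5" "j < 5"
      then have "(\<sigma> j \<in> ?s (\<sigma> i) \<or> \<sigma> i \<in> ?s (\<sigma> j)) \<longleftrightarrow>
          (i, j) \<in> ?arcs [1] \<or> (i, j) = (0, 2) \<or> (i, j) = (2, 0)"
        unfolding adj[OF ij, symmetric] by (auto simp: eq)
      also have "\<dots> \<longleftrightarrow> (i, j) \<in> ?arcs [1, 2]"
        by (auto simp: set_deviation_arcs)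
      finally show "(\<sigma> j \<in> ?s (\<sigma> i) \<or> \<sigma> i \<in> ?s (\<sigma> j)) \<longleftrightarrow> (i, j) \<in> ?arcs [1, 2]" .
    qed
    from cost_deviation[OF bij _ this, of b c]
    have "cost 5 b c ?s (\<sigma> 0) = ereal (real (card (s (\<sigma> 0))) + 1 + 9 * b + c)"
      using table_values card by simp
    moreover have "insert (\<sigma> 2) (s (\<sigma> 0)) \<in> strategies 5 (\<sigma> 0)"
      using su less[of 2] eq[of 2 0] by (auto simp: strategies_def)
    ultimately show ?thesis
      using nash[OF less[of 0], of "insert (\<sigma> 2) (s (\<sigma> 0))"] cost by simp
  qed
  moreover have "1 \<le> 2 * b + 4 * c"
  proof -
    let ?s = "s(\<sigma> 0 := s (\<sigma> 0) - {\<sigma> 1})"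
    \<comment> \<open>Positivity lets the truncated subtraction on cardinalities become a real
      one.\<close>
    have "card (s (\<sigma> 0)) > 0"
      using owner fin card_gt_0_iff by blast
    then have card: "real (card (?s (\<sigma> 0))) = real (card (s (\<sigma> 0))) - 1"
      using owner fin by simp
    have "s (\<sigma> 0) - {\<sigma> 1} \<in> strategies 5 (\<sigma> 0)"
      using su by (auto simp: strategies_def)
    then have ge: "\<not> cost 5 b c ?s (\<sigma> 0) < cost 5 b c s (\<sigma> 0)"
      using nash less[of 0] by simp
    \<comment> \<open>If both ends owned the edge, dropping one copy would keep the circle and save
      1.\<close>
    have single: "\<sigma> 0 \<notin> s (\<sigma> 1)"
    proof
      assume double: "\<sigma> 0 \<in> s (\<sigma> 1)"
      have "strategy_graph 5 ?s = \<lparr>pverts = {..<5}, parcs = map_prod \<sigma> \<sigma> ` ?arcs [1]\<rparr>"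
      proof (rule strategy_graph_relabelled[OF bij sub(2)])
        fix i j :: nat assume ij: "i < 5" "j < 5"
        then show "(\<sigma> j \<in> ?s (\<sigma> i) \<or> \<sigma> i \<in> ?s (\<sigma> j)) \<longleftrightarrow> (i, j) \<in> ?arcs [1]"
          unfolding adj[OF ij, symmetric] using double by (auto simp: eq)
      qed
      from cost_deviation[OF bij _ this, of b c] show False
        using ge cost table_values card by simp
    qed
    \<comment> \<open>Dropping the edge leaves a path with \<open>\<sigma> 0\<close> at its end:
      betweenness rises from 10 to 12 and closeness from 2 to 6, against a saving of 1.\<close>
    have "strategy_graph 5 ?s = \<lparr>pverts = {..<5}, parcs = map_prod \<sigma> \<sigma> ` ?arcs []\<rparr>"
    proof (rule strategy_graph_relabelled[OF bij sub(1)])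
      fix i j :: nat assume ij: "i < 5" "j < 5"
      then have "(\<sigma> j \<in> ?s (\<sigma> i) \<or> \<sigma> i \<in> ?s (\<sigma> j)) \<longleftrightarrow>
          (i, j) \<in> ?arcs [1] \<and> (i, j) \<noteq> (0, 1) \<and> (i, j) \<noteq> (1, 0)"
        unfolding adj[OF ij, symmetric] using single by (auto simp: eq)
      also have "\<dots> \<longleftrightarrow> (i, j) \<in> ?arcs []"
        by (auto simp: set_deviation_arcs)
      finally show "(\<sigma> j \<in> ?s (\<sigma> i) \<or> \<sigma> i \<in> ?s (\<sigma> j)) \<longleftrightarrow> (i, j) \<in> ?arcs []" .
    qed
    from cost_deviation[OF bij _ this, of b c] show ?thesis
      using ge cost table_values card by simp
  qed
  ultimately show ?thesis ..
qed

section \<open>Sufficiency of the two bounds\<close>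

lemma bounds_imp_circle_nash_equilibrium:
  assumes "b \<ge> 0" and "c > 0" and "b + c \<le> 1" and "1 \<le> 2 * b + 4 * c" and "circle_graph 5 G"
  shows "graph_nash_equilibrium 5 b c G"
proof -
  obtain \<sigma> where \<sigma>: "cycle_labelling \<sigma> G"
    using circle_graph_labelling[OF assms(5)] .
  then have bij: "bij_betw \<sigma> {..<5} {..<5}"
    by (simp add: cycle_labelling_def)
  \<comment> \<open>\<open>inv_into\<close> recovers the label of a player, who then buys the edge
    to the next label. The restricted abstraction supplies the extensionality that
    \<open>strategy_combinations\<close> demands.\<close>
  define s where "s = (\<lambda>x\<in>{..<5}. {\<sigma> (Suc (inv_into {..<5} \<sigma> x) mod 5)})"
  have s: "s (\<sigma> i) = {\<sigma> (Suc i mod 5)}" if "i < 5" for i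
    using bij that by (auto simp: s_def bij_betw_def)
  \<comment> \<open>Stated for every labelling that fits the successor rule, as it is applied to
    \<open>\<sigma>\<close> and to its rotations.\<close>
  have deviation: "strategy_graph 5 (s(\<tau> 0 := t)) =
      \<lparr>pverts = {..<5}, parcs = map_prod \<tau> \<tau> ` set (deviation_arcs T)\<rparr>"
    if \<tau>: "bij_betw \<tau> {..<5} {..<5}" "\<And>i. i < 5 \<Longrightarrow> s (\<tau> i) = {\<tau> (Suc i mod 5)}"
      and T: "set T \<subseteq> {1, 2, 3, 4}" "t = \<tau> ` set T" for \<tau> t T
  proof (rule strategy_graph_relabelled[OF \<tau>(1)])
    show "set (deviation_arcs T) \<subseteq> {..<5} \<times> {..<5}"
      using T(1) unfolding set_deviation_arcs by fastforce
    have eq: "\<tau> i = \<tau> j \<longleftrightarrow> i = j" if "i < 5" "j < 5" for i j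
      using \<tau>(1) that by (auto simp: bij_betw_def dest: inj_onD)
    have t: "\<tau> i \<in> t \<longleftrightarrow> i \<in> set T" if "i < 5" for i
      unfolding T(2) using T(1) \<tau>(1) that
      by (intro inj_on_image_mem_iff[of \<tau> "{..<5}"]) (auto simp: bij_betw_def)
    fix i j :: nat assume ij: "i < 5" "j < 5"
    have "(\<tau> j \<in> (s(\<tau> 0 := t)) (\<tau> i)) \<longleftrightarrow> (if i = 0 then j \<in> set T else j = Suc i mod 5)"
      if "i < 5" "j < 5" for i j
      using that by (simp add: eq t \<tau>(2))
    note mem = this[OF ij] this[OF ij(2,1)]
    have "0 \<notin> set T" using T(1) by auto
    show "(\<tau> j \<in> (s(\<tau> 0 := t)) (\<tau> i) \<or> \<tau> i \<in> (s(\<tau> 0 := t)) (\<tau> j)) \<longleftrightarrow>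
        (i, j) \<in> set (deviation_arcs T)"
      unfolding mem mem_deviation_arcs_iff[OF ij \<open>0 \<notin> set T\<close>] by (rule refl)
  qed
  have s_in: "s \<in> strategy_combinations 5"
    unfolding strategy_combinations_def
  proof (rule PiE_I)
    fix u :: nat assume "u \<in> {..<5}"
    then obtain i where i: "i < 5" "u = \<sigma> i"
      using bij by (metis bij_betw_def imageE lessThan_iff)
    moreover have "Suc i mod 5 \<noteq> i"
      using i(1) by presburger
    then have "\<sigma> (Suc i mod 5) \<noteq> \<sigma> i"
      using inj_on_eq_iff[of \<sigma> "{..<5}" "Suc i mod 5" i] bij i(1) by (simp add: bij_betw_def)
    moreover have "\<sigma> (Suc i mod 5) < 5"
      using bij_betwE[OF bij] by simp
    ultimately show "s u \<in> strategies 5 u"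
      by (simp add: s strategies_def)
  qed (simp add: s_def)
  \<comment> \<open>The left side is the cost on the circle. Among sets without 4, \<open>[]\<close>
    needs \<open>1 \<le> 2 * b + 4 * c\<close>; \<open>[1, 2]\<close>, \<open>[1, 3]\<close>,
    \<open>[2, 3]\<close> and \<open>[1, 2, 3]\<close> rest on \<open>b + c \<le> 1\<close>;
    \<open>[1]\<close> and \<open>[2]\<close> give equality and \<open>[3]\<close> follows from
    signs. Adding 4 only costs one more channel.\<close>
  have no_gain: "\<forall>T\<in>set (subseqs [1, 2, 3, 4]). 1 + b * 10 + c * 2 \<le>
      real (length T) + b * (12 - fst (deviation_value T)) + c * (real (snd (deviation_value T)) - 4)"
    using deviation_value_table assms(1-4) by simp
  have "cost 5 b c s u \<le> cost 5 b c (s(u := t)) u" if "u < 5" "t \<in> strategies 5 u" for u t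
  proof -
    have "u \<in> \<sigma> ` {..<5}"
      using that(1) bij_betw_imp_surj_on[OF bij] by simp
    then obtain k where k: "k < 5" "u = \<sigma> k" by auto
    \<comment> \<open>Rotating by \<open>k\<close> gives the deviating player label 0.\<close>
    define \<tau> where "\<tau> = (\<lambda>i. \<sigma> ((i + k) mod 5))"
    have \<tau>: "bij_betw \<tau> {..<5} {..<5}"
      using cycle_labelling_rotate[OF \<sigma> k(1)] by (simp add: cycle_labelling_def \<tau>_def)
    have u: "u = \<tau> 0"
      using k by (simp add: \<tau>_def)
    have step: "s (\<tau> i) = {\<tau> (Suc i mod 5)}" for i
      by (simp add: \<tau>_def s mod_simps)
    have inj: "inj_on \<tau> {..<5}"
      using \<tau> by (simp add: bij_betw_def)
    \<comment> \<open>The labels of \<open>t\<close> are listed as a subsequence of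
      \<open>[1, 2, 3, 4]\<close>, so that the finite table covers the deviation.\<close>
    have "{i \<in> {1, 2, 3, 4}. \<tau> i \<in> t} \<in> set ` set (subseqs [1, 2, 3, 4])"
      unfolding subseqs_powset by auto
    then obtain T where set_T: "{i \<in> {1, 2, 3, 4}. \<tau> i \<in> t} = set T"
      and T: "T \<in> set (subseqs [1, 2, 3, 4])"
      by (rule imageE)
    note set_T = set_T[symmetric]
    have sub: "set T \<subseteq> {1, 2, 3, 4}"
      unfolding set_T by auto
    have "distinct T"
      using subseqs_distinctD[OF T] by simp
    have t: "t = \<tau> ` set T"
    proof (intro subset_antisym subsetI)
      fix x assume x: "x \<in> t"
      then have "x \<in> \<tau> ` {..<5}" "x \<noteq> \<tau> 0"
        using that(2) bij_betw_imp_surj_on[OF \<tau>] by (auto simp: strategies_def u)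
      then obtain i where i: "i < 5" "x = \<tau> i" "i \<noteq> 0"
        by auto
      then have "i \<in> {1, 2, 3, 4}" by auto
      then show "x \<in> \<tau> ` set T"
        using i x unfolding set_T by blast
    qed (auto simp: set_T)
    have "card t = length T"
      unfolding t distinct_card[OF \<open>distinct T\<close>, symmetric]
      by (rule card_image[OF inj_on_subset[OF inj]]) (auto simp: set_T)
    then have "cost 5 b c (s(u := t)) u = ereal (real (length T) +
        b * (12 - fst (deviation_value T)) + c * (real (snd (deviation_value T)) - 4))"
      using cost_deviation[OF \<tau> T deviation[OF \<tau> step sub t], of b c]
      by (simp add: u)
    \<comment> \<open>The unchanged \<open>s\<close> is the trivial deviation with
      \<open>T = [1]\<close>, so the same cost formula applies to it.\<close>
    moreover have "strategy_graph 5 s =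
        \<lparr>pverts = {..<5}, parcs = map_prod \<tau> \<tau> ` set (deviation_arcs [1])\<rparr>"
      using deviation[of \<tau> "[1]" "s (\<tau> 0)", OF \<tau> step, unfolded fun_upd_triv]
      by (simp add: step)
    then have "cost 5 b c s u = ereal (1 +
        b * (12 - fst (deviation_value [1])) + c * (real (snd (deviation_value [1])) - 4))"
      using cost_deviation[OF \<tau>, of "[1]" s b c] by (simp add: u step)
    moreover have "deviation_value [1] = (2, 6)"
      using deviation_value_table by simp
    ultimately show ?thesis
      using bspec[OF no_gain T] by simp
  qed
  moreover have "G = strategy_graph 5 s"
  proof -
    have "strategy_graph 5 s = \<lparr>pverts = {..<5}, parcs = map_prod \<sigma> \<sigma> ` set (deviation_arcs [1])\<rparr>"
      using deviation[of \<sigma> "[1]" "s (\<sigma> 0)", OF bij s, unfolded fun_upd_triv]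
      by (simp add: s)
    then show ?thesis using \<sigma> by (simp add: cycle_labelling_def)
  qed
  ultimately show ?thesis
    using s_in by (auto simp: graph_nash_equilibrium_def nash_equilibrium_def not_less)
qed

theorem proposition4:
  fixes b c :: real and G :: "nat pair_pre_digraph"
  assumes "b \<ge> 0" and "c > 0"
    and "circle_graph 5 G"
  shows "graph_nash_equilibrium 5 b c G \<longleftrightarrow> b + c \<le> 1 \<and> 1 \<le> 2 * b + 4 * c"
  using circle_nash_equilibrium_imp_bounds[OF assms(3)]
    bounds_imp_circle_nash_equilibrium[OF assms(1,2) _ _ assms(3)]
  by blast

end
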